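(* Let $K$ be a field of characteristic $0$. Then: (i) $\mathcal V^+$ and $\mathcal V^-$ are $\mathcal P^\Phi$-submodules of $\mathcal V$; (ii) $\mathcal V^+=\langle v_{m,[m]}+v_{m,\emptyset}\rangle$ for any $m\ge0$; (iii) $\mathcal V^-=\langle v_{m,[m]}-v_{m,\emptyset}\rangle$ for any $m\ge1$; (iv) if $\mathcal U$ is a non-zero $\mathcal P^\Phi$-submodule of $\mathcal V$, then $\mathcal U$ contains either $\mathcal V^+$ or $\mathcal V^-$. Consequently, $\mathcal V^+$ and $\mathcal V^-$ are irreducible $\mathcal P^\Phi$-modules and $\mathcal V=\mathcal V^+\oplus\mathcal V^-$ as $\mathcal P^\Phi$-modules.
   Context: **Twisted partition category.** $\mathbb N=\{0,1,2,\ldots\}$, $[n]=\{1,\ldots,n\}$. For $A\subseteq\mathbb N$, $A'$ and $A''$ are disjoint copies of $A$. $\mathcal P_{m,n}$ is the set of all set partitions of $[m]\cup[n]'$; elements of $a$ are called $a$-blocks, and $a$ is identified with any graph whose connected components are its blocks. For $a\in\mathcal P_{m,n}$, $b\in\mathcal P_{n,t}$, the product graph $\Pi(a,b)$ has vertex set $[m]\cup[n]''\cup[t]'$ and edges those of $a$ (lower vertices $x'$ renamed $x''$) and of $b$ (upper vertices $x$ renamed $x''$). $ab\in\mathcal P_{m,t}$ is the partition in which $x,y\in[m]\cup[t]'$ are in the same block iff they are in the same component of $\Pi(a,b)$. $\Phi(a,b)$ is the number of connected components of $\Pi(a,b)$ contained in $[n]''$. $\mathcal P^\Phi$ is the category with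 objects $\mathbb N$, hom-sets $\mathcal P^\Phi_{m,n}=\mathbb N\times\mathcal P_{m,n}$, composition $(i,a)(j,b)=(i+j+\Phi(a,b),ab)$, and identities $(0,\iota_n)$ with $\iota_n=\{\{i,i'\}:i\in[n]\}$. For $a\in\mathcal P_{m,n}$, $\overline a$ is the $2^m\times2^n$ matrix over $K$, rows and columns indexed by subsets of $[m]$ and $[n]$, with $\overline a_{X,Y}=1$ if $X\cup Y'$ is a (possibly empty) union of $a$-blocks, and $0$ otherwise. **The module.** For $n\in\mathbb N$ let $\mathcal V_n=K^{2^n}$, column vectors indexed by subsets of $[n]$, with standard basis $\{v_{n,X}:X\subseteq[n]\}$. $\mathcal V$ is the family $(\mathcal V_n)_{n\in\mathbb N}$ (as a category: objects $\mathbb N$, only endomorphisms, $\mathcal V_n$ the endomorphisms of $n$ under vector addition). $\mathcal P^\Phi$ acts on $\mathcal V$ by $(i,a)\cdot v=2^i\,\overline a\,v\in\mathcal V_m$ for $(i,a)\in\mathcal P^\Phi_{m,n}$, $v\in\mathcal V_n$, making $\mathcal V$ a $\mathcal P^\Phi$-module. A $\mathcal P^\Phi$-submodule is a family $\mathcal U=(\mathcal U_n)_{n\in\mathbb N}$ of $K$-subspaces $\mathcal U_n\subseteq\mathcal V_n$ with $\mathcal P^\Phi_{m,n}\cdot\mathcal U_n\subseteq\mathcal U_m$ for all $m,n$; it is non-zero if some $\mathcal U_n\ne\{0\}$; containment and direct sums are taken componentwise; irreducible means having no submodules other than zero and itself. $\langle v\rangle$ denotes the $\mathcal P^\Phi$-submodule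 generated by $v$. For $X\subseteq[n]$ write $X^c=[n]\setminus X$. Put $\mathcal V_n^+=\mathrm{span}_K\{v_{n,X}+v_{n,X^c}:X\subseteq[n]\}$, $\mathcal V_n^-=\mathrm{span}_K\{v_{n,X}-v_{n,X^c}:X\subseteq[n]\}$, $\mathcal V^+=(\mathcal V_n^+)_{n\in\mathbb N}$, $\mathcal V^-=(\mathcal V^-_n)_{n\in\mathbb N}$. *)

theory Defs
  imports Complex_Main "HOL-Library.Disjoint_Sets" "HOL-Library.Function_Algebras"
begin

section \<open>The twisted partition category\<close>

text \<open>
  \<open>Plain x\<close>, \<open>Prime x\<close> and \<open>DPrime x\<close> stand for the vertices $x$, $x'$ and $x''$
  of the three disjoint copies of the natural numbers.
\<close>

datatype vertex = Plain nat | Prime nat | DPrime nat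

definition verts :: "nat \<Rightarrow> nat \<Rightarrow> vertex set" where
  "verts m n = Plain ` {1..m} \<union> Prime ` {1..n}"

definition partitions :: "nat \<Rightarrow> nat \<Rightarrow> vertex set set set" where
  "partitions m n = {a. partition_on (verts m n) a}"

fun lower_to_middle :: "vertex \<Rightarrow> vertex" where
  "lower_to_middle (Prime x) = DPrime x"
| "lower_to_middle v = v"

fun upper_to_middle :: "vertex \<Rightarrow> vertex" where
  "upper_to_middle (Plain x) = DPrime x"
| "upper_to_middle v = v"

definition product_verts :: "nat \<Rightarrow> nat \<Rightarrow> nat \<Rightarrow> vertex set" where
  "product_verts m n t = Plain ` {1..m} \<union> DPrime ` {1..n} \<union> Prime ` {1..t}"

text \<open>
  As a graph representing a partition we take the one in which any two vertices of a block are
  joined (the loops are harmless); the components of the product graph do not depend on which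
  representing graphs are chosen.
\<close>

definition product_edges :: "vertex set set \<Rightarrow> vertex set set \<Rightarrow> (vertex \<times> vertex) set" where
  "product_edges a b =
     (\<Union>A\<in>a. lower_to_middle ` A \<times> lower_to_middle ` A) \<union>
     (\<Union>B\<in>b. upper_to_middle ` B \<times> upper_to_middle ` B)"

definition product_components ::
  "nat \<Rightarrow> nat \<Rightarrow> nat \<Rightarrow> vertex set set \<Rightarrow> vertex set set \<Rightarrow> vertex set set" where
  "product_components m n t a b = product_verts m n t // (product_edges a b)\<^sup>*"

definition partition_product ::
  "nat \<Rightarrow> nat \<Rightarrow> nat \<Rightarrow> vertex set set \<Rightarrow> vertex set set \<Rightarrow> vertex set set" where
  "partition_product m n t a b =
     verts m t // {(x, y) \<in> verts m t \<times> verts m t.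
       \<exists>C \<in> product_components m n t a b. x \<in> C \<and> y \<in> C}"

definition floating ::
  "nat \<Rightarrow> nat \<Rightarrow> nat \<Rightarrow> vertex set set \<Rightarrow> vertex set set \<Rightarrow> nat" where
  "floating m n t a b = card {C \<in> product_components m n t a b. C \<subseteq> DPrime ` {1..n}}"

definition identity_partition :: "nat \<Rightarrow> vertex set set" where
  "identity_partition n = {{Plain i, Prime i} | i. i \<in> {1..n}}"

type_synonym morphism = "nat \<times> vertex set set"

definition twisted_hom :: "nat \<Rightarrow> nat \<Rightarrow> morphism set" where
  "twisted_hom m n = UNIV \<times> partitions m n"

definition twisted_comp :: "nat \<Rightarrow> nat \<Rightarrow> nat \<Rightarrow> morphism \<Rightarrow> morphism \<Rightarrow> morphism" where
  "twisted_comp m n t = (\<lambda>(i, a) (j, b).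
     (i + j + floating m n t a b, partition_product m n t a b))"

definition twisted_id :: "nat \<Rightarrow> morphism" where
  "twisted_id n = (0, identity_partition n)"


section \<open>The module of column vectors\<close>

text \<open>
  A column vector with entries indexed by the subsets of $\{1,\dots,n\}$ is a function on sets of
  naturals that vanishes outside \<open>Pow {1..n}\<close>.  Addition and zero are the pointwise ones.
\<close>

type_synonym 'k vect = "nat set \<Rightarrow> 'k"
type_synonym 'k family = "nat \<Rightarrow> 'k vect set"

definition vscale :: "'k::field \<Rightarrow> 'k vect \<Rightarrow> 'k vect" where
  "vscale c v = (\<lambda>X. c * v X)"

global_interpretation vect: vector_space "vscale :: 'k::field \<Rightarrow> 'k vect \<Rightarrow> 'k vect"
  by unfold_locales (auto simp: vscale_def fun_eq_iff algebra_simps)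

definition V :: "'k::field family" where
  "V n = {v. \<forall>X. \<not> X \<subseteq> {1..n} \<longrightarrow> v X = 0}"

text \<open>
  In this encoding the basis vector $v_{n,X}$ is the same function for every \<open>n\<close> with
  \<open>X \<subseteq> {1..n}\<close>, so \<open>n\<close> is not an argument.
\<close>

definition basis_vec :: "nat set \<Rightarrow> 'k::field vect" where
  "basis_vec X = (\<lambda>Y. if Y = X then 1 else 0)"

definition partition_matrix :: "vertex set set \<Rightarrow> nat set \<Rightarrow> nat set \<Rightarrow> 'k::field" where
  "partition_matrix a X Y = (if \<exists>B\<subseteq>a. Plain ` X \<union> Prime ` Y = \<Union>B then 1 else 0)"

definition act :: "nat \<Rightarrow> nat \<Rightarrow> morphism \<Rightarrow> 'k::field vect \<Rightarrow> 'k vect" where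
  "act m n = (\<lambda>(i, a) v X.
     if X \<subseteq> {1..m} then 2 ^ i * (\<Sum>Y\<in>Pow {1..n}. partition_matrix a X Y * v Y) else 0)"

text \<open>
  A family of subspaces that is a module over the twisted partition category under the action
  \<^const>\<open>act\<close>.
\<close>

definition twisted_module :: "'k::field family \<Rightarrow> bool" where
  "twisted_module U \<longleftrightarrow>
     (\<forall>n. vect.subspace (U n)) \<and>
     (\<forall>m n. \<forall>f\<in>twisted_hom m n. \<forall>u\<in>U n. act m n f u \<in> U m) \<and>
     (\<forall>m n. \<forall>f\<in>twisted_hom m n. \<forall>u\<in>U n. \<forall>w\<in>U n.
        act m n f (u + w) = act m n f u + act m n f w) \<and>
     (\<forall>m n. \<forall>f\<in>twisted_hom m n. \<forall>c. \<forall>u\<in>U n.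
        act m n f (vscale c u) = vscale c (act m n f u)) \<and>
     (\<forall>m n t. \<forall>f\<in>twisted_hom m n. \<forall>g\<in>twisted_hom n t. \<forall>u\<in>U t.
        act m n f (act n t g u) = act m t (twisted_comp m n t f g) u) \<and>
     (\<forall>n. \<forall>u\<in>U n. act n n (twisted_id n) u = u)"

definition submodule :: "'k::field family \<Rightarrow> 'k family \<Rightarrow> bool" where
  "submodule W U \<longleftrightarrow>
     (\<forall>n. vect.subspace (W n) \<and> W n \<subseteq> U n) \<and>
     (\<forall>m n. \<forall>f\<in>twisted_hom m n. act m n f ` W n \<subseteq> W m)"

definition nonzero :: "'k::field family \<Rightarrow> bool" where
  "nonzero U \<longleftrightarrow> (\<exists>n. U n \<noteq> {0})"

definition irreducible_module :: "'k::field family \<Rightarrow> bool" where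
  "irreducible_module U \<longleftrightarrow>
     twisted_module U \<and> (\<forall>W. submodule W U \<longrightarrow> \<not> nonzero W \<or> W = U)"

text \<open>The submodule of \<^const>\<open>V\<close> generated by a vector \<open>v \<in> V m\<close>.\<close>

definition generated :: "nat \<Rightarrow> 'k::field vect \<Rightarrow> 'k family" where
  "generated m v = (\<lambda>n. \<Inter>{W n | W. submodule W V \<and> v \<in> W m})"

definition direct_sum_of :: "'k::field family \<Rightarrow> 'k family \<Rightarrow> 'k family \<Rightarrow> bool" where
  "direct_sum_of U W1 W2 \<longleftrightarrow> submodule W1 U \<and> submodule W2 U \<and>
     (\<forall>n. U n = {u + w | u w. u \<in> W1 n \<and> w \<in> W2 n} \<and> W1 n \<inter> W2 n = {0})"

definition Vplus :: "'k::field family" where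
  "Vplus n = vect.span {basis_vec X + basis_vec ({1..n} - X) | X. X \<subseteq> {1..n}}"

definition Vminus :: "'k::field family" where
  "Vminus n = vect.span {basis_vec X - basis_vec ({1..n} - X) | X. X \<subseteq> {1..n}}"


section \<open>The column vectors form a module over the twisted partition category\<close>

lemma count_closed:
  assumes "finite P" and eq: "equiv P R" and "Q \<subseteq> P" "T \<subseteq> Q"
  shows "card {S. S \<subseteq> P \<and> R `` S \<subseteq> S \<and> S \<inter> Q = T} =
    (if R `` T \<inter> Q \<subseteq> T then 2 ^ card {C \<in> P // R. C \<inter> Q = {}} else 0)"
proof (cases "R `` T \<inter> Q \<subseteq> T")
  case False
  then have "{S. S \<subseteq> P \<and> R `` S \<subseteq> S \<and> S \<inter> Q = T} = {}" by blast
  then show ?thesis using False by (simp only: card.empty if_False)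
next
  case True
  have RP: "R \<subseteq> P \<times> P" using eq by (simp add: equiv_def refl_on_def)
  have refl: "\<And>x. x \<in> P \<Longrightarrow> (x,x) \<in> R" using eq by (meson equiv_def refl_onD)
  have sym: "\<And>x y. (x,y) \<in> R \<Longrightarrow> (y,x) \<in> R" using eq by (meson equiv_def symD)
  have tr: "\<And>x y z. (x,y) \<in> R \<Longrightarrow> (y,z) \<in> R \<Longrightarrow> (x,z) \<in> R" using eq by (meson equiv_def transD)
  let ?Fl = "{C \<in> P // R. C \<inter> Q = {}}"
  let ?f = "\<lambda>F. R `` T \<union> \<Union>F"
  let ?g = "\<lambda>S. {C \<in> ?Fl. C \<subseteq> S}"
  have cl: "R `` C \<subseteq> C" if "C \<in> P // R" for C
    using that tr by (auto elim!: quotientE)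
  have one: "\<And>C D x. C \<in> P // R \<Longrightarrow> D \<in> P // R \<Longrightarrow> x \<in> C \<Longrightarrow> x \<in> D \<Longrightarrow> C = D"
    using quotient_disj[OF eq] by blast
  have TR: "T \<subseteq> R `` T" using refl assms by blast
  have "bij_betw ?f (Pow ?Fl) {S. S \<subseteq> P \<and> R `` S \<subseteq> S \<and> S \<inter> Q = T}"
  proof (rule bij_betw_byWitness[where f' = ?g])
    show "\<forall>F\<in>Pow ?Fl. ?g (?f F) = F"
    proof
      fix F assume F: "F \<in> Pow ?Fl"
      show "?g (?f F) = F"
      proof
        show "F \<subseteq> ?g (?f F)" using F by blast
        show "?g (?f F) \<subseteq> F"
        proof
          fix C assume C: "C \<in> ?g (?f F)"
          then obtain x where x: "x \<in> C" using in_quotient_imp_non_empty[OF eq] by blast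
          have "x \<notin> R `` T"
          proof
            assume "x \<in> R `` T"
            then obtain y where "y \<in> T" "(y,x) \<in> R" by blast
            then have "y \<in> C" using sym x cl[of C] C by blast
            then show False using C \<open>y \<in> T\<close> assms by blast
          qed
          then obtain D where "D \<in> F" "x \<in> D" using C x by blast
          then show "C \<in> F" using one[of C D x] C F x by auto
        qed
      qed
    qed
    show "\<forall>S\<in>{S. S \<subseteq> P \<and> R `` S \<subseteq> S \<and> S \<inter> Q = T}. ?f (?g S) = S"
    proof
      fix S assume S: "S \<in> {S. S \<subseteq> P \<and> R `` S \<subseteq> S \<and> S \<inter> Q = T}"
      show "?f (?g S) = S"
      proof
        show "?f (?g S) \<subseteq> S" using S by blast
        show "S \<subseteq> ?f (?g S)"
        proof
          fix x assume x: "x \<in> S"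
          show "x \<in> ?f (?g S)"
          proof (cases "R `` {x} \<inter> Q = {}")
            case True
            then have "R `` {x} \<in> ?g S" using x S quotientI[of x P R] by blast
            moreover have "x \<in> R `` {x}" using x S refl by blast
            ultimately show ?thesis by blast
          next
            case False
            then obtain y where "(x,y) \<in> R" "y \<in> Q" by blast
            then have "y \<in> T" using S x by blast
            then show ?thesis using sym \<open>(x,y) \<in> R\<close> by blast
          qed
        qed
      qed
    qed
    show "?f ` Pow ?Fl \<subseteq> {S. S \<subseteq> P \<and> R `` S \<subseteq> S \<and> S \<inter> Q = T}"
    proof
      fix S assume "S \<in> ?f ` Pow ?Fl"
      then obtain F where F: "F \<subseteq> ?Fl" and S: "S = ?f F" by blast
      have "S \<subseteq> P" unfolding S using RP F Union_quotient[OF eq] by blast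
      moreover have "R `` S \<subseteq> S"
      proof
        fix y assume "y \<in> R `` S"
        then obtain x where x: "x \<in> S" "(x,y) \<in> R" by blast
        show "y \<in> S"
        proof (cases "x \<in> R `` T")
          case True then show ?thesis unfolding S using tr x by blast
        next
          case False
          then obtain C where "C \<in> F" "x \<in> C" using x S by blast
          then show ?thesis unfolding S using cl[of C] F x by blast
        qed
      qed
      moreover have "S \<inter> Q = T" unfolding S using True TR F assms by blast
      ultimately show "S \<in> {S. S \<subseteq> P \<and> R `` S \<subseteq> S \<and> S \<inter> Q = T}" by blast
    qed
    show "?g ` {S. S \<subseteq> P \<and> R `` S \<subseteq> S \<and> S \<inter> Q = T} \<subseteq> Pow ?Fl" by blast
  qed
  moreover have "finite ?Fl" using assms(1) RP by (simp add: finite_quotient)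
  ultimately show ?thesis using True by (simp add: bij_betw_same_card[symmetric] card_Pow)
qed

lemma union_of_blocks_iff:
  assumes "partition_on W a"
  shows "(\<exists>B\<subseteq>a. S = \<Union>B) \<longleftrightarrow> S \<subseteq> W \<and> (\<forall>A\<in>a. A \<inter> S \<noteq> {} \<longrightarrow> A \<subseteq> S)"
proof
  assume "\<exists>B\<subseteq>a. S = \<Union>B"
  then obtain B where B: "B \<subseteq> a" "S = \<Union>B" by blast
  have "A \<subseteq> S" if "A \<in> a" "A \<inter> S \<noteq> {}" for A
  proof -
    from that B obtain C where "C \<in> B" "A \<inter> C \<noteq> {}" by blast
    then have "A = C" using assms that B by (meson disjointD partition_on_def subsetD)
    then show ?thesis using B \<open>C \<in> B\<close> by blast
  qed
  then show "S \<subseteq> W \<and> (\<forall>A\<in>a. A \<inter> S \<noteq> {} \<longrightarrow> A \<subseteq> S)"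
    using assms B by (auto simp: partition_on_def)
next
  assume S: "S \<subseteq> W \<and> (\<forall>A\<in>a. A \<inter> S \<noteq> {} \<longrightarrow> A \<subseteq> S)"
  have "S = \<Union>{A\<in>a. A \<subseteq> S}"
  proof
    show "S \<subseteq> \<Union>{A\<in>a. A \<subseteq> S}"
    proof
      fix x assume x: "x \<in> S"
      then have "x \<in> \<Union>a" using S assms by (auto simp: partition_on_def)
      then obtain A where "A \<in> a" "x \<in> A" by blast
      moreover have "A \<inter> S \<noteq> {}" using \<open>x \<in> A\<close> x by (auto simp: disjoint_iff)
      ultimately have "A \<in> {A\<in>a. A \<subseteq> S}" using S by simp
      then show "x \<in> \<Union>{A\<in>a. A \<subseteq> S}" using \<open>x \<in> A\<close> by (rule UnionI)
    qed
  qed auto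
  moreover have "{A\<in>a. A \<subseteq> S} \<subseteq> a" by simp
  ultimately show "\<exists>B\<subseteq>a. S = \<Union>B" by (intro exI conjI)
qed

lemma closed_edges_iff:
  "(\<Union>A\<in>a. f ` A \<times> f ` A) `` S \<subseteq> S \<longleftrightarrow> (\<forall>A\<in>a. \<forall>v\<in>A. \<forall>w\<in>A. f v \<in> S \<longrightarrow> f w \<in> S)"
  by fast

lemma block_cond_iff:
  assumes "\<And>A v. A \<in> a \<Longrightarrow> v \<in> A \<Longrightarrow> f v \<in> S \<longleftrightarrow> v \<in> T"
  shows "(\<forall>A\<in>a. \<forall>v\<in>A. \<forall>w\<in>A. f v \<in> S \<longrightarrow> f w \<in> S) \<longleftrightarrow> (\<forall>A\<in>a. A \<inter> T \<noteq> {} \<longrightarrow> A \<subseteq> T)"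
  using assms by (simp add: disjoint_iff subset_iff) blast

lemma of_bool_conj_mult:
  "P \<Longrightarrow> Q \<Longrightarrow> (if P \<and> A then 1 else 0) * (if Q \<and> B then 1 else 0) = (if A \<and> B then 1 else (0::'a::field))"
  by simp

lemma matrix_product:
  fixes m n t a b X Z
  assumes a: "a \<in> partitions m n" and b: "b \<in> partitions n t" and X: "X \<subseteq> {1..m}" and Z: "Z \<subseteq> {1..t}"
  shows "(\<Sum>Y\<in>Pow {1..n}. partition_matrix a X Y * partition_matrix b Y Z) =
    2 ^ floating m n t a b * (partition_matrix (partition_product m n t a b) X Z :: 'k::field_char_0)"
proof -
  define E where "E = product_edges a b"
  define P where "P = product_verts m n t"
  define R where "R = E\<^sup>* \<inter> P \<times> P"
  define Q where "Q = verts m t"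
  define T where "T = Plain ` X \<union> Prime ` Z"
  let ?S = "\<lambda>Y. Plain ` X \<union> DPrime ` Y \<union> Prime ` Z"
  have pa: "partition_on (verts m n) a" and pb: "partition_on (verts n t) b"
    using a b by (auto simp: partitions_def)
  have lm: "lower_to_middle ` verts m n \<subseteq> P" and um: "upper_to_middle ` verts n t \<subseteq> P"
    by (auto simp: P_def Q_def verts_def product_verts_def)
  have EP: "E \<subseteq> P \<times> P"
    using lm um pa pb unfolding E_def product_edges_def partition_on_def by blast
  have "sym E" unfolding E_def product_edges_def sym_def by blast
  then have symE: "sym (E\<^sup>*)" by (rule sym_rtrancl)
  have EsP: "y \<in> P" if "(x,y) \<in> E\<^sup>*" "x \<in> P" for x y
    using that by (induction) (use EP in auto)
  have eq: "equiv P R"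
    apply (rule equivI)
       apply (auto simp: R_def refl_on_def)
    subgoal using symE by (auto simp: sym_def)
    subgoal by (auto simp: trans_def)
    done
  have q: "product_components m n t a b = P // R"
    unfolding product_components_def quotient_def E_def[symmetric] P_def[symmetric] R_def using EsP by auto
  have fin: "finite P" by (simp add: P_def product_verts_def)
  have QP: "Q \<subseteq> P" by (auto simp: P_def Q_def verts_def product_verts_def)
  have TQ: "T \<subseteq> Q" using X Z by (auto simp: T_def Q_def verts_def)
  have P': "P = Q \<union> DPrime ` {1..n}" by (auto simp: P_def Q_def verts_def product_verts_def)
  have dis: "Q \<inter> DPrime ` {1..n} = {}" by (auto simp: Q_def verts_def)
  have fl: "floating m n t a b = card {C \<in> P // R. C \<inter> Q = {}}"
    unfolding floating_def q
  proof (rule arg_cong[where f=card], rule Collect_cong)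
    fix C
    show "(C \<in> P // R \<and> C \<subseteq> DPrime ` {1..n}) = (C \<in> P // R \<and> C \<inter> Q = {})"
      using in_quotient_imp_subset[OF eq, of C] unfolding P' using dis by blast
  qed
  have eqQ: "equiv Q {(x,y) \<in> Q \<times> Q. (x,y) \<in> R}"
  proof (rule equivI)
    show "trans {(x,y) \<in> Q \<times> Q. (x,y) \<in> R}" using QP by (auto simp: R_def trans_def)
    show "sym {(x,y) \<in> Q \<times> Q. (x,y) \<in> R}" using QP symE by (auto simp: R_def sym_def)
  qed (use QP in \<open>auto simp: R_def refl_on_def\<close>)
  have rel: "{(x, y) \<in> Q \<times> Q. \<exists>C \<in> product_components m n t a b. x \<in> C \<and> y \<in> C}
     = {(x,y) \<in> Q \<times> Q. (x,y) \<in> R}"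
  proof -
    have "(\<exists>C \<in> P // R. x \<in> C \<and> y \<in> C) \<longleftrightarrow> (x,y) \<in> R" if "x \<in> Q" for x y
    proof
      assume "\<exists>C \<in> P // R. x \<in> C \<and> y \<in> C"
      then obtain C where "C \<in> P // R" "x \<in> C" "y \<in> C" by blast
      then show "(x,y) \<in> R" using in_quotient_imp_in_rel[OF eq, of C x y] by blast
    next
      assume xy: "(x,y) \<in> R"
      have "R `` {x} \<in> P // R" using that QP by (intro quotientI) blast
      moreover have "x \<in> R `` {x}" using that QP by (auto simp: R_def)
      moreover have "y \<in> R `` {x}" using xy by blast
      ultimately show "\<exists>C \<in> P // R. x \<in> C \<and> y \<in> C" by blast
    qed
    then show ?thesis unfolding q by blast
  qed
  have pab: "partition_on Q (partition_product m n t a b)"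
    unfolding partition_product_def Q_def[symmetric] rel using partition_on_quotient[OF eqQ] .
  have pm: "partition_matrix (partition_product m n t a b) X Z = (if R `` T \<inter> Q \<subseteq> T then 1 else (0::'k))"
  proof -
    have "(\<forall>A\<in>partition_product m n t a b. A \<inter> T \<noteq> {} \<longrightarrow> A \<subseteq> T) \<longleftrightarrow> R `` T \<inter> Q \<subseteq> T" (is "?l = ?r")
    proof
      assume l: ?l
      show ?r
      proof
        fix y assume "y \<in> R `` T \<inter> Q"
        then obtain x where x: "x \<in> T" "(x,y) \<in> R" "y \<in> Q" by blast
        define A where "A = {(x,y) \<in> Q \<times> Q. (x,y) \<in> R} `` {x}"
        have "A \<in> partition_product m n t a b"
          unfolding partition_product_def Q_def[symmetric] rel A_def using x TQ by (intro quotientI) blast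
        moreover have "x \<in> A" "y \<in> A" using x TQ QP by (auto simp: R_def A_def)
        ultimately show "y \<in> T" using l x by blast
      qed
    next
      assume r: ?r
      show ?l
      proof (intro ballI impI subsetI)
        fix A y assume A: "A \<in> partition_product m n t a b" "A \<inter> T \<noteq> {}" and y: "y \<in> A"
        then obtain x where "x \<in> A" "x \<in> T" by blast
        then have "(x,y) \<in> {(x,y) \<in> Q \<times> Q. (x,y) \<in> R}"
          using in_quotient_imp_in_rel[OF eqQ, of A x y] A y unfolding partition_product_def Q_def[symmetric] rel by blast
        then show "y \<in> T" using r \<open>x \<in> T\<close> by blast
      qed
    qed
    then show ?thesis unfolding partition_matrix_def T_def[symmetric] union_of_blocks_iff[OF pab] using TQ by simp
  qed
  have prod: "partition_matrix a X Y * partition_matrix b Y Z = (if R `` ?S Y \<subseteq> ?S Y then 1 else (0::'k))"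
    if Y: "Y \<subseteq> {1..n}" for Y
  proof -
    have SP: "?S Y \<subseteq> P" using X Y Z by (auto simp: P_def product_verts_def)
    have 1: "R `` ?S Y \<subseteq> ?S Y \<longleftrightarrow> E `` ?S Y \<subseteq> ?S Y"
    proof
      assume "R `` ?S Y \<subseteq> ?S Y"
      moreover have "E \<subseteq> R" unfolding R_def using EP by auto
      ultimately show "E `` ?S Y \<subseteq> ?S Y" by (meson Image_mono order_refl order_trans)
    next
      assume c: "E `` ?S Y \<subseteq> ?S Y"
      have "y \<in> ?S Y" if "(x,y) \<in> E\<^sup>*" "x \<in> ?S Y" for x y
        using that by induction (use c in blast)+
      then show "R `` ?S Y \<subseteq> ?S Y" unfolding R_def by blast
    qed
    let ?A = "Plain ` X \<union> Prime ` Y" and ?B = "Plain ` Y \<union> Prime ` Z"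
    have la: "lower_to_middle v \<in> ?S Y \<longleftrightarrow> v \<in> ?A" if "v \<in> verts m n" for v
      using that by (auto simp: verts_def)
    have lb: "upper_to_middle v \<in> ?S Y \<longleftrightarrow> v \<in> ?B" if "v \<in> verts n t" for v
      using that by (auto simp: verts_def)
    have av: "\<And>A v. A \<in> a \<Longrightarrow> v \<in> A \<Longrightarrow> v \<in> verts m n"
      and bv: "\<And>A v. A \<in> b \<Longrightarrow> v \<in> A \<Longrightarrow> v \<in> verts n t" using pa pb by (auto simp: partition_on_def)
    have 2: "E `` ?S Y \<subseteq> ?S Y \<longleftrightarrow>
       (\<forall>A\<in>a. \<forall>v\<in>A. \<forall>w\<in>A. lower_to_middle v \<in> ?S Y \<longrightarrow> lower_to_middle w \<in> ?S Y) \<and>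
       (\<forall>A\<in>b. \<forall>v\<in>A. \<forall>w\<in>A. upper_to_middle v \<in> ?S Y \<longrightarrow> upper_to_middle w \<in> ?S Y)"
      unfolding E_def product_edges_def Un_Image Un_subset_iff closed_edges_iff ..
    have 3: "(\<forall>A\<in>a. \<forall>v\<in>A. \<forall>w\<in>A. lower_to_middle v \<in> ?S Y \<longrightarrow> lower_to_middle w \<in> ?S Y)
       \<longleftrightarrow> (\<forall>A\<in>a. A \<inter> ?A \<noteq> {} \<longrightarrow> A \<subseteq> ?A)"
      by (rule block_cond_iff) (rule la[OF av])
    have 4: "(\<forall>A\<in>b. \<forall>v\<in>A. \<forall>w\<in>A. upper_to_middle v \<in> ?S Y \<longrightarrow> upper_to_middle w \<in> ?S Y)
       \<longleftrightarrow> (\<forall>A\<in>b. A \<inter> ?B \<noteq> {} \<longrightarrow> A \<subseteq> ?B)"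
      by (rule block_cond_iff) (rule lb[OF bv])
    have "?A \<subseteq> verts m n" "?B \<subseteq> verts n t" using X Y Z by (auto simp: verts_def)
    then show ?thesis
      unfolding partition_matrix_def union_of_blocks_iff[OF pa] union_of_blocks_iff[OF pb] 1 2 3 4 by (rule of_bool_conj_mult)
  qed
  have "(\<Sum>Y\<in>Pow {1..n}. partition_matrix a X Y * partition_matrix b Y Z :: 'k) =
     (\<Sum>Y\<in>Pow {1..n}. if R `` ?S Y \<subseteq> ?S Y then 1 else 0)"
    by (rule sum.cong) (use prod in auto)
  also have "\<dots> = of_nat (card {Y \<in> Pow {1..n}. R `` ?S Y \<subseteq> ?S Y})"
    by (simp add: sum.If_cases Int_def)
  also have "card {Y \<in> Pow {1..n}. R `` ?S Y \<subseteq> ?S Y} = card {S. S \<subseteq> P \<and> R `` S \<subseteq> S \<and> S \<inter> Q = T}"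
  proof (rule bij_betw_same_card[of ?S])
    have "inj_on ?S (Pow {1..n})" by (rule inj_on_inverseI[where g="\<lambda>S. {y. DPrime y \<in> S}"]) auto
    moreover have "?S ` {Y \<in> Pow {1..n}. R `` ?S Y \<subseteq> ?S Y} = {S. S \<subseteq> P \<and> R `` S \<subseteq> S \<and> S \<inter> Q = T}"
    proof (intro equalityI subsetI)
      fix S assume "S \<in> ?S ` {Y \<in> Pow {1..n}. R `` ?S Y \<subseteq> ?S Y}"
      then obtain Y where Y: "Y \<subseteq> {1..n}" "R `` ?S Y \<subseteq> ?S Y" "S = ?S Y" by blast
      have s: "?S Y \<subseteq> P" "?S Y \<inter> Q = T"
        using X Y(1) Z by (auto simp: P_def Q_def T_def product_verts_def verts_def)
      show "S \<in> {S. S \<subseteq> P \<and> R `` S \<subseteq> S \<and> S \<inter> Q = T}"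
        unfolding Y(3) mem_Collect_eq by (intro conjI s Y(2))
    next
      fix S assume S: "S \<in> {S. S \<subseteq> P \<and> R `` S \<subseteq> S \<and> S \<inter> Q = T}"
      let ?Y = "{y. DPrime y \<in> S}"
      have SY: "S = ?S ?Y"
      proof -
        have "S = (S \<inter> Q) \<union> (S \<inter> DPrime ` {1..n})" using S P' by blast
        also have "S \<inter> Q = Plain ` X \<union> Prime ` Z" using S T_def by blast
        also have "S \<inter> DPrime ` {1..n} = DPrime ` ?Y" using S P' by (auto simp: Q_def verts_def)
        finally show ?thesis by (simp only: Un_assoc Un_commute[of "Prime ` Z"])
      qed
      have "?Y \<subseteq> {1..n}" using S P' by (auto simp: Q_def verts_def)
      moreover have "R `` ?S ?Y \<subseteq> ?S ?Y" using S unfolding SY[symmetric] by blast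
      ultimately have "?Y \<in> {Y \<in> Pow {1..n}. R `` ?S Y \<subseteq> ?S Y}" by (intro CollectI conjI PowI)
      then show "S \<in> ?S ` {Y \<in> Pow {1..n}. R `` ?S Y \<subseteq> ?S Y}"
        by (rule image_eqI[of S ?S ?Y, OF SY])
    qed
    ultimately show "bij_betw ?S {Y \<in> Pow {1..n}. R `` ?S Y \<subseteq> ?S Y}
       {S. S \<subseteq> P \<and> R `` S \<subseteq> S \<and> S \<inter> Q = T}"
      unfolding bij_betw_def by (intro conjI) (erule inj_on_subset, rule Collect_restrict)
  qed
  finally show ?thesis
    unfolding count_closed[OF fin eq QP TQ] fl pm by simp
qed

lemma identity_matrix:
  assumes "X \<subseteq> {1..n}" "Y \<subseteq> {1..n}"
  shows "partition_matrix (identity_partition n) X Y = (if X = Y then 1 else 0)"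
proof -
  have "(\<exists>B\<subseteq>identity_partition n. Plain ` X \<union> Prime ` Y = \<Union>B) \<longleftrightarrow> X = Y"
  proof
    assume "X = Y"
    then have "Plain ` X \<union> Prime ` Y = \<Union>((\<lambda>i. {Plain i, Prime i}) ` X)" by auto
    moreover have "(\<lambda>i. {Plain i, Prime i}) ` X \<subseteq> identity_partition n"
      using assms unfolding identity_partition_def by blast
    ultimately show "\<exists>B\<subseteq>identity_partition n. Plain ` X \<union> Prime ` Y = \<Union>B" by blast
  next
    assume "\<exists>B\<subseteq>identity_partition n. Plain ` X \<union> Prime ` Y = \<Union>B"
    then obtain B where B: "B \<subseteq> identity_partition n" "Plain ` X \<union> Prime ` Y = \<Union>B" by blast
    have "Plain i \<in> \<Union>B \<longleftrightarrow> Prime i \<in> \<Union>B" for i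
    proof -
      have "Plain i \<in> C \<longleftrightarrow> Prime i \<in> C" if "C \<in> B" for C
      proof -
        have "C \<in> identity_partition n" using that B(1) by blast
        then obtain k where "C = {Plain k, Prime k}" unfolding identity_partition_def by blast
        then show ?thesis by simp
      qed
      then show ?thesis by blast
    qed
    moreover have "Plain i \<in> \<Union>B \<longleftrightarrow> i \<in> X" "Prime i \<in> \<Union>B \<longleftrightarrow> i \<in> Y" for i
      unfolding B(2)[symmetric] by auto
    ultimately show "X = Y" by blast
  qed
  then show ?thesis by (simp add: partition_matrix_def)
qed

lemma twisted_module_V: "twisted_module (V :: 'k::field_char_0 family)"
  unfolding twisted_module_def
proof (intro conjI allI ballI)
  fix n show "vect.subspace (V n :: 'k vect set)"
    by (auto simp: vect.subspace_def V_def vscale_def)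
next
  fix m n f u assume "u \<in> (V n :: 'k vect set)"
  show "act m n f u \<in> (V m :: 'k vect set)" by (cases f) (auto simp: V_def act_def)
next
  fix m n f and u w :: "'k vect"
  show "act m n f (u + w) = act m n f u + act m n f w"
    by (cases f) (auto simp: act_def fun_eq_iff algebra_simps sum.distrib)
next
  fix m n f c and u :: "'k vect"
  show "act m n f (vscale c u) = vscale c (act m n f u)"
    by (cases f) (auto simp: act_def fun_eq_iff vscale_def sum_distrib_left mult_ac)
next
  fix m n t f g and u :: "'k vect"
  assume "f \<in> twisted_hom m n" "g \<in> twisted_hom n t" "u \<in> V t"
  then obtain i a j b where f: "f = (i,a)" "a \<in> partitions m n" and g: "g = (j,b)" "b \<in> partitions n t"
    by (auto simp: twisted_hom_def)
  show "act m n f (act n t g u) = act m t (twisted_comp m n t f g) u"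
  proof
    fix X
    show "act m n f (act n t g u) X = act m t (twisted_comp m n t f g) u X"
    proof (cases "X \<subseteq> {1..m}")
      case False then show ?thesis by (simp add: f g act_def twisted_comp_def)
    next
      case True
      have "act m n f (act n t g u) X = 2^i * (\<Sum>Y\<in>Pow {1..n}. partition_matrix a X Y *
          (2^j * (\<Sum>Z\<in>Pow {1..t}. partition_matrix b Y Z * u Z)))"
        using True by (auto simp: act_def f g intro!: sum.cong)
      also have "\<dots> = 2^(i+j) * (\<Sum>Y\<in>Pow {1..n}. \<Sum>Z\<in>Pow {1..t}. partition_matrix a X Y * partition_matrix b Y Z * u Z)"
        by (simp add: sum_distrib_left power_add mult_ac)
      also have "\<dots> = 2^(i+j) * (\<Sum>Z\<in>Pow {1..t}. (\<Sum>Y\<in>Pow {1..n}. partition_matrix a X Y * partition_matrix b Y Z) * u Z)"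
        by (subst sum.swap) (simp add: sum_distrib_right)
      also have "\<dots> = 2^(i+j) * (\<Sum>Z\<in>Pow {1..t}. 2 ^ floating m n t a b * partition_matrix (partition_product m n t a b) X Z * u Z)"
        using matrix_product[OF f(2) g(2) True, where 'k='k] by simp
      also have "\<dots> = act m t (twisted_comp m n t f g) u X"
        using True by (simp add: act_def f g twisted_comp_def sum_distrib_left power_add mult_ac)
      finally show ?thesis .
    qed
  qed
next
  fix n and u :: "'k vect" assume u: "u \<in> V n"
  show "act n n (twisted_id n) u = u"
  proof
    fix X
    have "(\<Sum>Y\<in>Pow {1..n}. partition_matrix (identity_partition n) X Y * u Y) =
       (\<Sum>Y\<in>Pow {1..n}. if X = Y then u Y else 0)" if "X \<subseteq> {1..n}"
      by (intro sum.cong refl) (simp only: identity_matrix[OF that PowD], simp)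
    then show "act n n (twisted_id n) u X = u X"
      using u by (auto simp: act_def twisted_id_def V_def)
  qed
qed

end

theory Submission imports Defs begin

text \<open>
  Complementing a union of blocks of a partition gives a union of blocks, so every matrix
  $\overline a$ is invariant under simultaneous complementation of its row and column labels
  (\<open>partition_matrix_complement\<close>).  The action therefore commutes with the involution
  $v_{n,X} \mapsto v_{n,X^c}$ of \<open>V\<close>, and its eigenspaces for the eigenvalues $s = \pm 1$ are
  submodules.  They are $\mathcal V^+$ and $\mathcal V^-$, and since $2$ is invertible they are
  complementary.  Most of the proof treats both at once, with $s$ as a parameter.

  Everything else uses only partitions with at most two blocks, $A \cup B'$ and its complement.
  The matrix of such a partition has its ones at the positions $(\emptyset, \emptyset)$,
  $(A, B)$, $(A^c, B^c)$ and $([m], [n])$, some of which may coincide (\<open>act_two_blocks\<close>).  Two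
  consequences carry the theorem.

  \<^item> With $B = [m]$, $m \ge 1$ and $A = X \ne [n]$, the vector $v_{[m]} + s v_\emptyset$ is sent to
    $(v_X + s v_{X^c}) + (v_{[n]} + s v_\emptyset)$, and with $A = [n]$ to the second summand
    alone.  So this single vector generates the $s$-eigenspaces
    (\<open>eigenspace_generated\<close>).

  \<^item> A non-zero vector with a non-zero entry at $X$ is sent by a suitable two-block partition to
    a non-zero vector $w = \alpha v_{\{1\}} + \beta v_\emptyset$ of degree $1$
    (\<open>submodule_degree_one\<close>).  Projecting $w$ to degree $0$ gives
    $(\alpha + \beta) v_\emptyset$.  If this is non-zero, it generates $\mathcal V^+$;
    otherwise $w$ is a multiple of the generator $v_{\{1\}} - v_\emptyset$ of $\mathcal V^-$
    (\<open>submodule_contains_eigenspace\<close>).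

  Irreducibility follows, because the two eigenspaces meet only in $0$ and are both non-zero in
  degree $1$.
\<close>

section \<open>Complementation and its eigenspaces\<close>

definition complement_eigenspace :: "'k::field \<Rightarrow> 'k family" where
  "complement_eigenspace s n = {v \<in> V n. \<forall>X\<subseteq>{1..n}. v ({1..n} - X) = s * v X}"

lemma partition_matrix_complement:
  assumes "a \<in> partitions m n" "X \<subseteq> {1..m}" "Y \<subseteq> {1..n}"
  shows "partition_matrix a ({1..m} - X) ({1..n} - Y) = partition_matrix a X Y"
proof -
  have p: "partition_on (verts m n) a"
    using assms(1) by (simp add: partitions_def)
  let ?S = "Plain ` X \<union> Prime ` Y"
  let ?T = "Plain ` ({1..m} - X) \<union> Prime ` ({1..n} - Y)"
  have T: "?T = verts m n - ?S" and S: "?S \<subseteq> verts m n"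
    using assms by (auto simp: verts_def)
  have compl: "(A \<inter> (W - S) \<noteq> {} \<longrightarrow> A \<subseteq> W - S) \<longleftrightarrow> (A \<inter> S \<noteq> {} \<longrightarrow> A \<subseteq> S)"
    if "A \<subseteq> W" for A W S :: "vertex set"
    using that by blast
  have "A \<subseteq> verts m n" if "A \<in> a" for A
    using p that by (auto simp: partition_on_def)
  then have "(\<forall>A\<in>a. A \<inter> ?T \<noteq> {} \<longrightarrow> A \<subseteq> ?T) \<longleftrightarrow> (\<forall>A\<in>a. A \<inter> ?S \<noteq> {} \<longrightarrow> A \<subseteq> ?S)"
    unfolding T by (intro ball_cong refl compl)
  then show ?thesis
    unfolding partition_matrix_def union_of_blocks_iff[OF p] using S T by simp
qed

lemma sum_Pow_complement:
  "(\<Sum>Y\<in>Pow S. f (S - Y)) = (\<Sum>Y\<in>Pow S. f Y)"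
  by (rule sum.reindex_bij_witness[where i="\<lambda>Y. S - Y" and j="\<lambda>Y. S - Y"]) auto

lemma subspace_complement_eigenspace: "vect.subspace (complement_eigenspace s n)"
  unfolding vect.subspace_def complement_eigenspace_def V_def vscale_def
  by (simp add: distrib_left mult.left_commute)

lemma submodule_complement_eigenspace:
  "submodule (complement_eigenspace s) (V :: 'k::field_char_0 family)"
  unfolding submodule_def
proof (intro conjI allI ballI image_subsetI)
  fix n
  show "vect.subspace (complement_eigenspace s n)"
    by (rule subspace_complement_eigenspace)
  show "complement_eigenspace s n \<subseteq> V n"
    by (auto simp: complement_eigenspace_def)
next
  fix m n f v
  assume f: "f \<in> twisted_hom m n" and v: "v \<in> complement_eigenspace s n"
  obtain i a where fa: "f = (i, a)" and a: "a \<in> partitions m n"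
    using f by (auto simp: twisted_hom_def)
  have "act m n f v ({1..m} - X) = s * act m n f v X" if X: "X \<subseteq> {1..m}" for X
  proof -
    have "(\<Sum>Y\<in>Pow {1..n}. partition_matrix a ({1..m} - X) Y * v Y)
        = (\<Sum>Y\<in>Pow {1..n}. partition_matrix a ({1..m} - X) ({1..n} - Y) * v ({1..n} - Y))"
      by (rule sum_Pow_complement[symmetric])
    also have "\<dots> = (\<Sum>Y\<in>Pow {1..n}. s * (partition_matrix a X Y * v Y))"
    proof (rule sum.cong[OF refl])
      fix Y assume "Y \<in> Pow {1..n}"
      then have Y: "Y \<subseteq> {1..n}" by blast
      have "v ({1..n} - Y) = s * v Y"
        using v Y unfolding complement_eigenspace_def by blast
      then show "partition_matrix a ({1..m} - X) ({1..n} - Y) * v ({1..n} - Y)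
          = s * (partition_matrix a X Y * v Y)"
        by (simp only: partition_matrix_complement[OF a X Y] mult.left_commute)
    qed
    finally show ?thesis
      using X by (auto simp: fa act_def sum_distrib_left mult.left_commute)
  qed
  moreover have "act m n f v \<in> V m"
    by (auto simp: fa act_def V_def)
  ultimately show "act m n f v \<in> complement_eigenspace s m"
    by (simp add: complement_eigenspace_def)
qed

lemma sum_fun_apply: "(\<Sum>i\<in>I. f i) x = (\<Sum>i\<in>I. f i x)"
  by (induction I rule: infinite_finite_induct) auto

text \<open>
  A vector \<open>v\<close> of the eigenspace is the average of its expansion \<open>\<Sum>X. v X \<cdot> basis_vec X\<close> and the
  complemented expansion, which is a combination of the spanning vectors.
\<close>

lemma complement_eigenspace_eq_span:
  fixes s :: "'k::field_char_0"
  assumes s: "s * s = 1"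
  shows "complement_eigenspace s n =
    vect.span {basis_vec X + vscale s (basis_vec ({1..n} - X)) | X. X \<subseteq> {1..n}}"
    (is "_ = vect.span ?G")
proof
  have "basis_vec X + vscale s (basis_vec ({1..n} - X)) \<in> complement_eigenspace s n"
    if X: "X \<subseteq> {1..n}" for X
  proof -
    have "{1..n} - Y = X \<longleftrightarrow> Y = {1..n} - X" "{1..n} - Y = {1..n} - X \<longleftrightarrow> Y = X"
      if "Y \<subseteq> {1..n}" for Y
      using that X by blast+
    then show ?thesis
      using X s by (auto simp: complement_eigenspace_def V_def vscale_def basis_vec_def algebra_simps)
  qed
  then show "vect.span ?G \<subseteq> complement_eigenspace s n"
    by (intro vect.span_minimal subspace_complement_eigenspace) blast
next
  show "complement_eigenspace s n \<subseteq> vect.span ?G"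
  proof
    fix v assume v: "v \<in> complement_eigenspace s n"
    let ?g = "\<lambda>X. basis_vec X + vscale s (basis_vec ({1..n} - X))"
    have "v = vscale (1/2) (\<Sum>X\<in>Pow {1..n}. vscale (v X) (?g X))"
    proof
      fix Y
      show "v Y = vscale (1/2) (\<Sum>X\<in>Pow {1..n}. vscale (v X) (?g X)) Y"
      proof (cases "Y \<subseteq> {1..n}")
        case False
        then have "(\<Sum>X\<in>Pow {1..n}. v X * ?g X Y) = 0"
          by (intro sum.neutral) (auto simp: basis_vec_def vscale_def)
        moreover have "v Y = 0"
          using v False by (simp add: complement_eigenspace_def V_def)
        ultimately show ?thesis
          by (simp add: vscale_def sum_fun_apply)
      next
        case True
        have "(\<Sum>X\<in>Pow {1..n}. v X * ?g X Y)
            = (\<Sum>X\<in>Pow {1..n}. (if X = Y then v X else 0)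
                + (if X = {1..n} - Y then s * v X else 0))"
        proof (rule sum.cong[OF refl])
          fix X assume "X \<in> Pow {1..n}"
          then have "Y = {1..n} - X \<longleftrightarrow> X = {1..n} - Y" using True by blast
          then show "v X * ?g X Y = (if X = Y then v X else 0)
                + (if X = {1..n} - Y then s * v X else 0)"
            by (auto simp: basis_vec_def vscale_def distrib_left)
        qed
        also have "\<dots> = v Y + s * v ({1..n} - Y)"
          using True by (simp add: sum.distrib)
        also have "v ({1..n} - Y) = s * v Y"
          using v True unfolding complement_eigenspace_def by blast
        also have "v Y + s * (s * v Y) = 2 * v Y"
          using s by (simp add: mult.assoc[symmetric])
        finally show ?thesis
          by (simp add: vscale_def sum_fun_apply)
      qed
    qed
    also have "\<dots> \<in> vect.span ?G"
      by (intro vect.span_scale vect.span_sum vect.span_base) blast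
    finally show "v \<in> vect.span ?G" .
  qed
qed

lemma Vplus_eq: "(Vplus :: 'k::field_char_0 family) = complement_eigenspace 1"
  by (rule ext) (simp add: Vplus_def complement_eigenspace_eq_span)

lemma plus_vscale_minus_one: "v + vscale (-1) w = v - (w :: 'k::field vect)"
  by (simp add: vscale_def fun_eq_iff)

lemma Vminus_eq: "(Vminus :: 'k::field_char_0 family) = complement_eigenspace (-1)"
  by (rule ext) (simp add: Vminus_def complement_eigenspace_eq_span plus_vscale_minus_one)

lemma complement_eigenspaces_disjoint:
  "complement_eigenspace 1 n \<inter> complement_eigenspace (-1) n = {0 :: 'k::field_char_0 vect}"
proof (intro equalityI subsetI)
  fix v :: "'k vect"
  assume v: "v \<in> complement_eigenspace 1 n \<inter> complement_eigenspace (-1) n"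
  have "v X = 0" for X
  proof (cases "X \<subseteq> {1..n}")
    case True
    then have "v ({1..n} - X) = 1 * v X" "v ({1..n} - X) = -1 * v X"
      using v unfolding complement_eigenspace_def by blast+
    then show ?thesis by simp
  next
    case False
    then show ?thesis using v by (simp add: complement_eigenspace_def V_def)
  qed
  then show "v \<in> {0}" by (simp add: fun_eq_iff)
qed (simp add: vect.subspace_0[OF subspace_complement_eigenspace])

lemma direct_sum_eigenspaces:
  "direct_sum_of (V :: 'k::field_char_0 family) (complement_eigenspace 1) (complement_eigenspace (-1))"
  unfolding direct_sum_of_def
proof (intro conjI allI submodule_complement_eigenspace complement_eigenspaces_disjoint)
  fix n :: nat
  let ?c = "\<lambda>v X. if X \<subseteq> {1..n} then v ({1..n} - X) else (0 :: 'k)"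
  show "(V n :: 'k vect set) =
    {u + w |u w. u \<in> complement_eigenspace 1 n \<and> w \<in> complement_eigenspace (-1) n}"
  proof (intro equalityI subsetI)
    fix v :: "'k vect" assume v: "v \<in> V n"
    have dd: "{1..n} - ({1..n} - X) = X" if "X \<subseteq> {1..n}" for X :: "nat set"
      using that by blast
    have "vscale (1/2) (v + ?c v) \<in> complement_eigenspace 1 n"
      "vscale (1/2) (v - ?c v) \<in> complement_eigenspace (-1) n"
      using v dd by (auto simp: complement_eigenspace_def V_def vscale_def algebra_simps)
    moreover have "v = vscale (1/2) (v + ?c v) + vscale (1/2) (v - ?c v)"
      by (simp add: vscale_def fun_eq_iff field_simps)
    ultimately show
      "v \<in> {u + w |u w. u \<in> complement_eigenspace 1 n \<and> w \<in> complement_eigenspace (-1) n}"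
      by blast
  next
    fix v :: "'k vect"
    assume "v \<in> {u + w |u w. u \<in> complement_eigenspace 1 n \<and> w \<in> complement_eigenspace (-1) n}"
    then obtain u w :: "'k vect" where uw: "v = u + w" "u \<in> V n" "w \<in> V n"
      unfolding complement_eigenspace_def by blast
    show "v \<in> V n"
      using uw by (simp add: V_def)
  qed
qed

section \<open>The action of partitions with at most two blocks\<close>

text \<open>Removing the empty set leaves a single block when one of the two halves is empty.\<close>

definition two_blocks :: "nat \<Rightarrow> nat \<Rightarrow> nat set \<Rightarrow> nat set \<Rightarrow> vertex set set" where
  "two_blocks m n A B =
    {Plain ` A \<union> Prime ` B, Plain ` ({1..m} - A) \<union> Prime ` ({1..n} - B)} - {{}}"

lemma two_blocks_union:
  assumes "A \<subseteq> {1..m}" "B \<subseteq> {1..n}"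
  shows "(Plain ` A \<union> Prime ` B) \<union> (Plain ` ({1..m} - A) \<union> Prime ` ({1..n} - B)) = verts m n"
proof -
  have "A \<union> ({1..m} - A) = {1..m}" "B \<union> ({1..n} - B) = {1..n}"
    using assms by blast+
  then have "verts m n = Plain ` (A \<union> ({1..m} - A)) \<union> Prime ` (B \<union> ({1..n} - B))"
    by (simp only: verts_def)
  then show ?thesis
    by (simp only: image_Un Un_ac)
qed

lemma two_blocks_partition:
  assumes "A \<subseteq> {1..m}" "B \<subseteq> {1..n}"
  shows "two_blocks m n A B \<in> partitions m n"
proof -
  have "\<Union>({P, Q} - {{}}) = P \<union> Q" for P Q :: "vertex set"
    by auto
  then have union: "\<Union>(two_blocks m n A B) = verts m n"
    unfolding two_blocks_def two_blocks_union[OF assms, symmetric] .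
  have disj: "disjoint ({P, Q} - {{}})" if "P \<inter> Q = {}" for P Q :: "vertex set"
    using that by (auto simp: disjoint_def)
  have "disjoint (two_blocks m n A B)"
    unfolding two_blocks_def by (rule disj) auto
  moreover have "{} \<notin> two_blocks m n A B"
    by (simp add: two_blocks_def)
  ultimately show ?thesis
    using union by (simp add: partitions_def partition_on_def)
qed

definition two_blocks_ones :: "nat \<Rightarrow> nat \<Rightarrow> nat set \<Rightarrow> nat set \<Rightarrow> (nat set \<times> nat set) set" where
  "two_blocks_ones m n A B = {({}, {}), (A, B), ({1..m} - A, {1..n} - B), ({1..m}, {1..n})}"

lemma partition_matrix_two_blocks:
  assumes A: "A \<subseteq> {1..m}" and B: "B \<subseteq> {1..n}"
  shows "partition_matrix (two_blocks m n A B) X Y =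
    (if (X, Y) \<in> two_blocks_ones m n A B then 1 else 0)"
proof -
  let ?S = "Plain ` X \<union> Prime ` Y"
  let ?P = "Plain ` A \<union> Prime ` B" and ?Q = "Plain ` ({1..m} - A) \<union> Prime ` ({1..n} - B)"
  have inj: "Plain ` X \<union> Prime ` Y = Plain ` X' \<union> Prime ` Y' \<longleftrightarrow> X = X' \<and> Y = Y'" for X' Y'
  proof
    assume eq: "Plain ` X \<union> Prime ` Y = Plain ` X' \<union> Prime ` Y'"
    have "X = {x. Plain x \<in> ?S}" "Y = {x. Prime x \<in> ?S}" by auto
    moreover have "X' = {x. Plain x \<in> ?S}" "Y' = {x. Prime x \<in> ?S}" unfolding eq by auto
    ultimately show "X = X' \<and> Y = Y'" by simp
  qed simp
  have union: "?P \<union> ?Q = Plain ` {1..m} \<union> Prime ` {1..n}"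
    using two_blocks_union[OF A B] by (simp only: verts_def)
  have "(\<exists>C\<subseteq>{P, Q} - {{}}. S = \<Union>C) \<longleftrightarrow> S = {} \<or> S = P \<or> S = Q \<or> S = P \<union> Q"
    for P Q S :: "vertex set"
  proof
    assume "S = {} \<or> S = P \<or> S = Q \<or> S = P \<union> Q"
    then have "S = \<Union>({} - {{}}) \<or> S = \<Union>({P} - {{}}) \<or> S = \<Union>({Q} - {{}}) \<or> S = \<Union>({P, Q} - {{}})"
      by auto
    moreover have "{} - {{}} \<subseteq> {P, Q} - {{}}" "{P} - {{}} \<subseteq> {P, Q} - {{}}" "{Q} - {{}} \<subseteq> {P, Q} - {{}}"
      by auto
    ultimately show "\<exists>C\<subseteq>{P, Q} - {{}}. S = \<Union>C"
      by (metis order_refl)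
  next
    assume "\<exists>C\<subseteq>{P, Q} - {{}}. S = \<Union>C"
    then obtain C where C: "C \<subseteq> {P, Q}" "S = \<Union>C" by blast
    from C(1) have "C = {} \<or> C = {P} \<or> C = {Q} \<or> C = {P, Q}" by blast
    then show "S = {} \<or> S = P \<or> S = Q \<or> S = P \<union> Q" unfolding C(2) by auto
  qed
  then have "(\<exists>C\<subseteq>two_blocks m n A B. ?S = \<Union>C) \<longleftrightarrow>
      ?S = {} \<or> ?S = ?P \<or> ?S = ?Q \<or> ?S = Plain ` {1..m} \<union> Prime ` {1..n}"
    unfolding two_blocks_def union[symmetric] .
  also have "\<dots> \<longleftrightarrow> (X, Y) \<in> two_blocks_ones m n A B"
    unfolding inj by (auto simp: two_blocks_ones_def)
  finally show ?thesis
    unfolding partition_matrix_def by simp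
qed

lemma act_two_blocks:
  assumes "A \<subseteq> {1..m}" "B \<subseteq> {1..n}" "X \<subseteq> {1..m}"
  shows "act m n (0, two_blocks m n A B) v X = (\<Sum>Y | (X, Y) \<in> two_blocks_ones m n A B. v Y)"
proof -
  have "{Y. (X, Y) \<in> two_blocks_ones m n A B} \<subseteq> Pow {1..n}"
    using assms by (auto simp: two_blocks_ones_def)
  then have "(\<Sum>Y | (X, Y) \<in> two_blocks_ones m n A B. v Y) =
      (\<Sum>Y\<in>Pow {1..n}. if (X, Y) \<in> two_blocks_ones m n A B then v Y else 0)"
    by (intro sum.mono_neutral_cong_left) auto
  then show ?thesis
    using assms by (simp add: act_def partition_matrix_two_blocks if_distrib[of "\<lambda>x. x * _"] cong: if_cong)
qed

lemma submodule_act_two_blocks: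
  assumes "submodule W V" "v \<in> W n" "A \<subseteq> {1..m}" "B \<subseteq> {1..n}"
  shows "act m n (0, two_blocks m n A B) v \<in> W m"
  using assms two_blocks_partition[of A m B n]
  unfolding submodule_def twisted_hom_def by blast

section \<open>Generators of the eigenspaces\<close>

text \<open>
  The partition attached to a proper subset \<open>X\<close> yields the spanning vector for \<open>X\<close> plus the one for
  \<open>{1..n}\<close>; the one-block partition, which is the case \<open>X = {1..n}\<close>, yields the latter alone, so it can
  be subtracted.  For \<open>m = 0\<close> the sets \<open>{1..m}\<close> and \<open>{}\<close> coincide, and for \<open>s = -1\<close> the given
  vector would be \<open>0\<close>.
\<close>

lemma eigenspace_generated:
  fixes s :: "'k::field_char_0"
  assumes W: "submodule W V" and s: "s * s = 1" and m: "m \<ge> 1"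
    and gen: "basis_vec {1..m} + vscale s (basis_vec {}) \<in> W m"
  shows "complement_eigenspace s n \<subseteq> W n"
proof -
  define v where "v = basis_vec {1..m} + vscale s (basis_vec {})"
  let ?act = "\<lambda>X. act n m (0, two_blocks n m X {1..m}) v"
  let ?g = "\<lambda>X. basis_vec X + vscale s (basis_vec ({1..n} - X)) :: 'k vect"
  have sub: "vect.subspace (W n)" using W by (simp add: submodule_def)
  have ne: "{1..m} \<noteq> {}" using m by simp
  have vY: "v Y = (if Y = {1..m} then 1 else if Y = {} then s else 0)" for Y
    using ne by (auto simp: v_def basis_vec_def vscale_def)
  have mem: "?act X \<in> W n" if "X \<subseteq> {1..n}" for X
    by (rule submodule_act_two_blocks[OF W gen[folded v_def] that order_refl])
  have act: "?act X Z = (if Z = {} \<or> Z = {1..n} - X then s else 0) +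
      (if Z = X \<or> Z = {1..n} then 1 else 0)" if X: "X \<subseteq> {1..n}" and Z: "Z \<subseteq> {1..n}" for X Z
  proof -
    have "{Y. (Z, Y) \<in> two_blocks_ones n m X {1..m}} =
        (if Z = {} \<or> Z = {1..n} - X then {{}} else {}) \<union> (if Z = X \<or> Z = {1..n} then {{1..m}} else {})"
      by (auto simp: two_blocks_ones_def)
    moreover have "sum v ((if P then {{}} else {}) \<union> (if Q then {{1..m}} else {})) =
        (if P then s else 0) + (if Q then 1 else 0)" for P Q
      using ne ne[symmetric] vY[of "{}"] vY[of "{1..m}"] by (cases P; cases Q) simp_all
    ultimately show ?thesis
      unfolding act_two_blocks[OF X order_refl Z] by simp
  qed
  have outside: "?act X Z = 0" if "\<not> Z \<subseteq> {1..n}" for X Z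
    using that by (simp add: act_def)
  have g: "?g X Z = (if Z = X then 1 else 0) + (if Z = {1..n} - X then s else 0)" for X Z
    by (simp add: basis_vec_def vscale_def)
  have full: "?g {1..n} = ?act {1..n}"
  proof
    fix Z
    show "?g {1..n} Z = ?act {1..n} Z"
    proof (cases "Z \<subseteq> {1..n}")
      case True
      then show ?thesis unfolding g unfolding act[OF order_refl True] Diff_cancel by simp
    next
      case False
      then have "Z \<noteq> {1..n}" "Z \<noteq> {}" by blast+
      then show ?thesis unfolding g outside[OF False] by simp
    qed
  qed
  have proper: "?g X = ?act X - ?act {1..n}" if X: "X \<subseteq> {1..n}" "X \<noteq> {1..n}" for X
  proof
    fix Z
    \<comment> \<open>Names for the two sets keep the comparison of coefficients purely propositional.\<close>
    define N where "N = {1..n}"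
    define D where "D = N - X"
    have D: "D \<noteq> {}" "D \<subseteq> N" and XN: "X \<noteq> N" "X \<subseteq> N"
      using X by (auto simp: D_def N_def)
    show "?g X Z = (?act X - ?act {1..n}) Z"
    proof (cases "Z \<subseteq> {1..n}")
      case True
      have N0: "N \<noteq> {}" using D by blast
      have g': "?g X Z = (if Z = X then 1 else 0) + (if Z = D then s else 0)"
        unfolding D_def N_def by (rule g)
      have X': "?act X Z = (if Z = {} \<or> Z = D then s else 0) + (if Z = X \<or> Z = N then 1 else 0)"
        unfolding D_def N_def by (rule act[OF X(1) True])
      have N': "?act {1..n} Z = (if Z = {} then s else 0) + (if Z = N then 1 else 0)"
        using act[OF order_refl True] unfolding Diff_cancel N_def by simp
      show ?thesis
        unfolding minus_apply g' X' N' using D(1) XN(1) N0 by auto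
    next
      case False
      then have "Z \<noteq> X" "Z \<noteq> {1..n} - X" using X by blast+
      then show ?thesis unfolding minus_apply g outside[OF False] by simp
    qed
  qed
  have "?g X \<in> W n" if X: "X \<subseteq> {1..n}" for X
  proof (cases "X = {1..n}")
    case True
    then show ?thesis using full mem[of "{1..n}"] by simp
  next
    case False
    then show ?thesis
      unfolding proper[OF X False] using X by (intro vect.subspace_diff[OF sub] mem) auto
  qed
  then have "{?g X | X. X \<subseteq> {1..n}} \<subseteq> W n" by blast
  then show ?thesis
    unfolding complement_eigenspace_eq_span[OF s] by (rule vect.span_minimal[OF _ sub])
qed

text \<open>
  Degree \<open>0\<close> is reduced to degree \<open>1\<close> by the partition with the single block \<open>{Plain 1}\<close>.
\<close>

lemma eigenspace_one_generated_degree_zero: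
  assumes W: "submodule W (V :: 'k::field_char_0 family)" and "v \<in> W 0" "v {} \<noteq> 0"
  shows "complement_eigenspace 1 n \<subseteq> W n"
proof -
  let ?w = "act 1 0 (0, two_blocks 1 0 {1} {}) v"
  have w: "?w \<in> W 1"
    using submodule_act_two_blocks[OF W assms(2)] by simp
  have "?w Z = v {} * (basis_vec {1..1} + vscale 1 (basis_vec {})) Z" for Z
  proof (cases "Z \<subseteq> {1}")
    case True
    then have "Z = {} \<or> Z = {1}" by blast
    then have "{Y. (Z, Y) \<in> two_blocks_ones 1 0 {1} {}} = {{}}"
      by (auto simp: two_blocks_ones_def)
    moreover have "?w Z = (\<Sum>Y | (Z, Y) \<in> two_blocks_ones 1 0 {1} {}. v Y)"
      by (rule act_two_blocks) (use True in auto)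
    ultimately have "?w Z = v {}"
      by simp
    moreover have "(basis_vec {1..1} + vscale 1 (basis_vec {})) Z = (1 :: 'k)"
      using \<open>Z = {} \<or> Z = {1}\<close> by (auto simp: basis_vec_def vscale_def)
    ultimately show ?thesis
      by simp
  next
    case False
    then show ?thesis by (auto simp: act_def basis_vec_def vscale_def)
  qed
  then have "vscale (inverse (v {})) ?w = basis_vec {1..1} + vscale 1 (basis_vec {})"
    using assms(3) by (simp add: vscale_def fun_eq_iff mult.assoc[symmetric])
  moreover have "vscale (inverse (v {})) ?w \<in> W 1"
    using W w by (intro vect.subspace_scale) (auto simp: submodule_def)
  ultimately show ?thesis
    by (intro eigenspace_generated[OF W, of 1 1]) auto
qed

lemma generated_least:
  assumes "submodule W V" "v \<in> W m"
  shows "generated m v n \<subseteq> W n"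
  using assms unfolding generated_def by blast

lemma generator_in_eigenspace:
  assumes "s * s = (1 :: 'k::field_char_0)"
  shows "basis_vec {1..m} + vscale s (basis_vec {}) \<in> complement_eigenspace s m"
  unfolding complement_eigenspace_eq_span[OF assms] by (intro vect.span_base CollectI exI[of _ "{1..m}"]) simp

section \<open>Every non-zero submodule contains an eigenspace\<close>

text \<open>
  A column of a two-block matrix indexed by \<open>{}\<close>, \<open>B\<close>, its complement or \<open>{1..n}\<close> is non-zero, and all
  other columns vanish.  For \<open>B = {1..n}\<close> the entries at \<open>{}\<close> and \<open>{1..n}\<close> survive unmixed.  If they
  are both \<open>0\<close>, the choice \<open>B = X\<close> isolates a non-zero entry at \<open>X\<close>, because what it is added to
  is the entry at \<open>{1..n}\<close>.
\<close>

lemma submodule_degree_one: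
  assumes U: "submodule U V" and "nonzero U"
  obtains w where "w \<in> U 1" "w {} \<noteq> 0 \<or> w {1} \<noteq> 0"
proof -
  obtain n u where u: "u \<in> U n" "u \<noteq> 0"
  proof -
    obtain n where "U n \<noteq> {0}" using assms(2) by (auto simp: nonzero_def)
    moreover have "0 \<in> U n"
      using U by (auto simp: submodule_def vect.subspace_def)
    ultimately show ?thesis using that by blast
  qed
  obtain X where X: "u X \<noteq> 0" using u(2) by (auto simp: fun_eq_iff)
  have Xn: "X \<subseteq> {1..n}"
    using U u(1) X by (auto simp: submodule_def V_def)
  show ?thesis
  proof (cases "u {} = 0 \<and> u {1..n} = 0")
    case False
    let ?w = "act 1 n (0, two_blocks 1 n {1} {1..n}) u"
    have "{Y. ({}, Y) \<in> two_blocks_ones 1 n {1} {1..n}} = {{}}"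
      "{Y. ({1}, Y) \<in> two_blocks_ones 1 n {1} {1..n}} = {{1..n}}"
      by (auto simp: two_blocks_ones_def)
    then have "?w {} = u {}" "?w {1} = u {1..n}"
      by (simp_all add: act_two_blocks)
    moreover have "?w \<in> U 1"
      by (rule submodule_act_two_blocks[OF U u(1)]) auto
    ultimately show ?thesis using False that by metis
  next
    case True
    then have "X \<noteq> {1..n}" using X by auto
    let ?w = "act 1 n (0, two_blocks 1 n {1} X) u"
    have "{Y. ({1}, Y) \<in> two_blocks_ones 1 n {1} X} = {X, {1..n}}"
      by (auto simp: two_blocks_ones_def)
    then have "?w {1} = u X"
      using True Xn \<open>X \<noteq> {1..n}\<close> by (simp add: act_two_blocks)
    moreover have "?w \<in> U 1"
      by (rule submodule_act_two_blocks[OF U u(1)]) (use Xn in auto)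
    ultimately show ?thesis using X that by metis
  qed
qed

text \<open>
  The partition with the single block \<open>{Prime 1}\<close> sends a vector of degree \<open>1\<close> to the sum of its two
  entries, times the basis vector of degree \<open>0\<close>.  This sum decides which of the two eigenspaces is found.
\<close>

lemma submodule_contains_eigenspace:
  assumes U: "submodule U (V :: 'k::field_char_0 family)" and "nonzero U"
  shows "(\<forall>n. complement_eigenspace 1 n \<subseteq> U n) \<or> (\<forall>n. complement_eigenspace (-1) n \<subseteq> U n)"
proof -
  obtain w where w: "w \<in> U 1" and nz: "w {} \<noteq> 0 \<or> w {1} \<noteq> 0"
    using submodule_degree_one[OF assms] .
  let ?z = "act 0 1 (0, two_blocks 0 1 {} {1}) w"
  have z: "?z \<in> U 0"
    by (rule submodule_act_two_blocks[OF U w]) auto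
  have "{Y. ({}, Y) \<in> two_blocks_ones 0 1 {} {1}} = {{}, {1}}"
    by (auto simp: two_blocks_ones_def)
  then have z0: "?z {} = w {} + w {1}"
    by (simp add: act_two_blocks)
  show ?thesis
  proof (cases "?z {} = 0")
    case False
    then show ?thesis using eigenspace_one_generated_degree_zero[OF U z] by blast
  next
    case True
    then have sum0: "w {} = - w {1}" using z0 by (simp add: eq_neg_iff_add_eq_0)
    then have w1: "w {1} \<noteq> 0" using nz by auto
    have "w Z = w {1} * (basis_vec {1..1} + vscale (-1) (basis_vec {})) Z" for Z
    proof (cases "Z \<subseteq> {1}")
      case True
      then have "Z = {} \<or> Z = {1}" by blast
      then show ?thesis using sum0 by (auto simp: basis_vec_def vscale_def)
    next
      case False
      moreover have "w \<in> V 1"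
        using w U unfolding submodule_def by blast
      ultimately have "w Z = 0"
        by (simp add: V_def)
      then show ?thesis using False by (auto simp: basis_vec_def vscale_def)
    qed
    then have "vscale (inverse (w {1})) w Z = (basis_vec {1..1} + vscale (-1) (basis_vec {})) Z" for Z
      using w1 unfolding vscale_def by (metis (no_types, lifting) left_inverse mult.assoc mult_1)
    then have "vscale (inverse (w {1})) w = basis_vec {1..1} + vscale (-1) (basis_vec {})"
      by blast
    moreover have "vscale (inverse (w {1})) w \<in> U 1"
      using U w by (intro vect.subspace_scale) (auto simp: submodule_def)
    ultimately have "complement_eigenspace (-1) n \<subseteq> U n" for n
      by (intro eigenspace_generated[OF U, of _ 1]) auto
    then show ?thesis by blast
  qed
qed

section \<open>Irreducibility\<close>

lemma submodule_trans:
  assumes "submodule W U" "submodule U T"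
  shows "submodule W T"
proof -
  have "W n \<subseteq> T n" for n
    using assms by (meson order_trans submodule_def)
  then show ?thesis
    using assms(1) by (simp add: submodule_def)
qed

lemma twisted_module_submodule:
  assumes sub: "submodule U T" and T: "twisted_module T"
  shows "twisted_module U"
proof -
  have le: "u \<in> T n" if "u \<in> U n" for u n
    using sub that unfolding submodule_def by blast
  have "vect.subspace (U n)" for n
    using sub by (simp add: submodule_def)
  moreover have "act m n f u \<in> U m" if "f \<in> twisted_hom m n" "u \<in> U n" for m n f u
    using sub that unfolding submodule_def by blast
  ultimately show ?thesis
    using T le unfolding twisted_module_def by simp
qed

text \<open>
  A non-zero submodule contains one of the two eigenspaces.  It cannot be the opposite one, whose
  generator in degree \<open>1\<close> would then lie in both eigenspaces.
\<close>

lemma irreducible_complement_eigenspace: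
  fixes s :: "'k::field_char_0"
  assumes s: "s = 1 \<or> s = -1"
  shows "irreducible_module (complement_eigenspace s)"
  unfolding irreducible_module_def
proof (intro conjI allI impI)
  show "twisted_module (complement_eigenspace s)"
    by (rule twisted_module_submodule[OF submodule_complement_eigenspace twisted_module_V])
  fix W assume W: "submodule W (complement_eigenspace s)"
  have le: "W n \<subseteq> complement_eigenspace s n" for n
    using W by (simp add: submodule_def)
  have WV: "submodule W V"
    by (rule submodule_trans[OF W submodule_complement_eigenspace])
  show "\<not> nonzero W \<or> W = complement_eigenspace s"
  proof (cases "nonzero W")
    case True
    have "\<not> complement_eigenspace (-s) 1 \<subseteq> W 1"
    proof
      let ?v = "basis_vec {1..1} + vscale (-s) (basis_vec {}) :: 'k vect"
      assume "complement_eigenspace (-s) 1 \<subseteq> W 1"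
      moreover have v: "?v \<in> complement_eigenspace (-s) 1"
        by (rule generator_in_eigenspace) (use s in auto)
      ultimately have "?v \<in> complement_eigenspace s 1" using le by blast
      then have "?v \<in> complement_eigenspace 1 1 \<inter> complement_eigenspace (-1) 1"
        using s v by auto
      then have "?v = 0" unfolding complement_eigenspaces_disjoint by blast
      then have "?v {1} = 0" by (simp only: zero_fun_apply)
      then show False by (simp add: basis_vec_def vscale_def)
    qed
    then have "complement_eigenspace s n \<subseteq> W n" for n
      using submodule_contains_eigenspace[OF WV True] s by (metis minus_minus)
    then show ?thesis using le by (auto simp: fun_eq_iff)
  qed simp
qed

text \<open>
  That the vector generates enough is a hypothesis, because for \<open>s = 1\<close> it also holds in degree
  \<open>m = 0\<close>, for a different reason than in positive degrees.
\<close>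

lemma eigenspace_eq_generated:
  fixes s :: "'k::field_char_0"
  assumes s: "s * s = 1"
    and least: "\<And>W n. submodule W V \<Longrightarrow> basis_vec {1..m} + vscale s (basis_vec {}) \<in> W m
      \<Longrightarrow> complement_eigenspace s n \<subseteq> W n"
  shows "complement_eigenspace s = generated m (basis_vec {1..m} + vscale s (basis_vec {}))"
proof (intro ext equalityI)
  fix n
  show "complement_eigenspace s n \<subseteq> generated m (basis_vec {1..m} + vscale s (basis_vec {})) n"
    using least unfolding generated_def by blast
  show "generated m (basis_vec {1..m} + vscale s (basis_vec {})) n \<subseteq> complement_eigenspace s n"
    by (rule generated_least[OF submodule_complement_eigenspace generator_in_eigenspace[OF s]])
qed

theorem theorem4p4:
  shows "submodule (Vplus :: 'k::field_char_0 family) V \<and>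
    submodule (Vminus :: 'k family) V \<and>
    (\<forall>m. (Vplus :: 'k family) = generated m (basis_vec {1..m} + basis_vec {})) \<and>
    (\<forall>m\<ge>1. (Vminus :: 'k family) = generated m (basis_vec {1..m} - basis_vec {})) \<and>
    (\<forall>U :: 'k family. submodule U V \<and> nonzero U \<longrightarrow>
       (\<forall>n. Vplus n \<subseteq> U n) \<or> (\<forall>n. Vminus n \<subseteq> U n)) \<and>
    irreducible_module (Vplus :: 'k family) \<and>
    irreducible_module (Vminus :: 'k family) \<and>
    direct_sum_of (V :: 'k family) Vplus Vminus"
proof (intro conjI allI impI)
  fix m
  have "complement_eigenspace (1 :: 'k) n \<subseteq> W n"
    if W: "submodule W V" and gen: "basis_vec {1..m} + vscale 1 (basis_vec {}) \<in> W m" for W n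
  proof (cases "m = 0")
    case True
    \<comment> \<open>In degree \<open>0\<close> the full and the empty set coincide, and the generator is \<open>2\<close> times the
      basis vector.\<close>
    show ?thesis
      by (rule eigenspace_one_generated_degree_zero[OF W, of "basis_vec {1..m} + vscale 1 (basis_vec {})"])
        (use gen True in \<open>auto simp: basis_vec_def vscale_def\<close>)
  next
    case False
    then show ?thesis by (intro eigenspace_generated[OF W _ _ gen]) auto
  qed
  then have "complement_eigenspace 1 = generated m (basis_vec {1..m} + vscale (1 :: 'k) (basis_vec {}))"
    by (intro eigenspace_eq_generated) auto
  moreover have "vscale 1 v = v" for v :: "'k vect"
    by (simp add: vscale_def)
  ultimately show "(Vplus :: 'k family) = generated m (basis_vec {1..m} + basis_vec {})"
    by (simp add: Vplus_eq)
next
  fix m :: nat assume "m \<ge> 1"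
  then show "(Vminus :: 'k family) = generated m (basis_vec {1..m} - basis_vec {})"
    unfolding Vminus_eq plus_vscale_minus_one[symmetric]
    by (intro eigenspace_eq_generated eigenspace_generated) auto
qed (simp_all add: Vplus_eq Vminus_eq submodule_complement_eigenspace submodule_contains_eigenspace
    irreducible_complement_eigenspace direct_sum_eigenspaces)

end
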